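(* Let $\mathcal{W}_{CG}$ be the set of coarse-grained scalar quantum walks with coordination number two on the infinite dihedral group $D_\infty$ (up to local change of basis), and let $\mathcal{W}_P$ be the set of parity invariant quantum walks with coordination number two on $\ell^2(\mathbb{Z})\otimes\mathbb{C}^2$. Then $\mathcal{W}_{CG}=\mathcal{W}_P$.
   Context: For a discrete group $G$, $T$ denotes the right regular representation on $\ell^2(G)$, $T_g|x\rangle=|xg^{-1}\rangle$. Scalar quantum walk. A scalar quantum walk on $G$ is a unitary operator on $\ell^2(G)$ of the form $A=\sum_{h\in S_+}z_hT_h$, where $S_+\subseteq G$ is a finite generating set of $G$ (every element of $G$ is a product of elements of $S_+$ and their inverses; $S_+$ need not be symmetric and may contain the identity $e$) and all $z_h\in\mathbb{C}\setminus\{0\}$. Quantum walks with coordination number two on $\ell^2(\mathbb{Z})\otimes\mathbb{C}^2$. Write $\mathbb{Z}=\langle a\rangle$ multiplicatively. Such a walk is a unitary operator $W=T_a\otimes A_{+}+T_{a^{-1}}\otimes A_{-}+T_e\otimes A_e$ with $2\times2$ complex matrices $A_+\ne0$, $A_-\neq0$ and $A_e$ (possibly zero). It is identified with its symbol $A_k=e^{-ik}A_++e^{ik}A_-+A_e$, a unitary $2\times 2$ matrix for every $k\in[-\pi,\pi]$. Coarse-graining. Let $D_\infty=\langle a,r\mid r^2,\ rar^{-1}a\rangle=\mathbb{Z}\rtimes\mathbb{Z}_2$, $H=\langle a\rangle\cong\mathbb{Z}$, and choose coset representatives $c_1\in H$, $c_2\in Hr$, so that $D_\infty=Hc_1\cup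 Hc_2$. Let $U_H:\ell^2(D_\infty)\to\ell^2(H)\otimes\mathbb{C}^2$ be the unitary $U_H|xc_j\rangle=|x\rangle|j\rangle$ for $x\in H$, $j=1,2$, with $\{|1\rangle,|2\rangle\}$ the canonical basis of $\mathbb{C}^2$. For a scalar quantum walk $A=\sum_{h\in S_+}z_hT_h$ on $D_\infty$ its coarse-graining is $$\mathcal{R}[A]=U_HAU_H^\dagger=\sum_{h\in S_+}\sum_{j=1,2}z_h\,T_{c_{\tau(h,j)}hc_j^{-1}}\otimes|\tau(h,j)\rangle\langle j|,$$ where $\tau(h,j)\in\{1,2\}$ is the index with $c_jh^{-1}\in Hc_{\tau(h,j)}$, and $T$ on the right-hand side is the right regular representation of $H$. The coarse-grained walk has coordination number two if all elements $c_{\tau(h,j)}hc_j^{-1}$ ($h\in S_+$, $j=1,2$) lie in $\{e,a,a^{-1}\}$; in that case $\mathcal{R}[A]=T_a\otimes A_++T_{a^{-1}}\otimes A_-+T_e\otimes A_e$ for $2\times2$ complex matrices $A_\pm,A_e$, and it is identified with its symbol $A_k=e^{-ik}A_++e^{ik}A_-+A_e$, $k\in[-\pi,\pi]$. $\mathcal{W}_{CG}$ is the set of all walks with symbol $UA_kU^\dagger$, where $U$ is a $k$-independent unitary $2\times2$ matrix (local change of basis) and $A_k$ is the symbol of a coarse-graining $\mathcal{R}[A]$ with coordination number two of some scalar quantum walk $A$ on $D_\infty$ (for some finite generating set and some choice of coset representatives). $\mathcal{W}_P$ is the set of all quantum walks with coordination number two on $\ell^2(\mathbb{Z})\otimes\mathbb{C}^2$,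 with symbol $A_k$, for which there is a $2\times2$ matrix $P$ with $P=P^\dagger=P^{-1}$, $P\neq I$, such that $PA_kP^\dagger=A_{-k}$ for all $k$. *)

theory Defs
  imports "HOL-Analysis.Analysis" "HOL-Algebra.Elementary_Groups"
begin

subsection \<open>Square-summable functions and unitary operators\<close>

text \<open>
  An element of the Hilbert space over an index set X is a complex function that vanishes
  outside X. Operators are restricted to this set (they are \<open>undefined\<close> elsewhere), so that
  HOL equality of operators is equality on the Hilbert space.
\<close>

definition l2 :: "'i set \<Rightarrow> ('i \<Rightarrow> complex) set" where
  "l2 X = {f. (\<forall>x. x \<notin> X \<longrightarrow> f x = 0) \<and> (\<lambda>x. (cmod (f x))\<^sup>2) summable_on X}"

definition l2_inner :: "'i set \<Rightarrow> ('i \<Rightarrow> complex) \<Rightarrow> ('i \<Rightarrow> complex) \<Rightarrow> complex" where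
  "l2_inner X f g = (\<Sum>\<^sub>\<infinity>x\<in>X. cnj (f x) * g x)"

definition ket :: "'i \<Rightarrow> 'i \<Rightarrow> complex" where
  "ket x = (\<lambda>y. if y = x then 1 else 0)"

definition unitary_op :: "'i set \<Rightarrow> (('i \<Rightarrow> complex) \<Rightarrow> ('i \<Rightarrow> complex)) \<Rightarrow> bool" where
  "unitary_op X W \<longleftrightarrow>
     W ` l2 X = l2 X \<and>
     (\<forall>f\<in>l2 X. \<forall>g\<in>l2 X. \<forall>\<alpha> \<beta>.
        W (\<lambda>x. \<alpha> * f x + \<beta> * g x) = (\<lambda>x. \<alpha> * W f x + \<beta> * W g x)) \<and>
     (\<forall>f\<in>l2 X. \<forall>g\<in>l2 X. l2_inner X (W f) (W g) = l2_inner X f g)"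

definition dagger :: "complex^2^2 \<Rightarrow> complex^2^2" where
  "dagger M = (\<chi> i j. cnj (M $ j $ i))"

definition unitary_matrix :: "complex^2^2 \<Rightarrow> bool" where
  "unitary_matrix U \<longleftrightarrow> U ** dagger U = mat 1 \<and> dagger U ** U = mat 1"


subsection \<open>Right regular representation and scalar quantum walks\<close>

definition rreg :: "('g, 'b) monoid_scheme \<Rightarrow> 'g \<Rightarrow> ('g \<Rightarrow> complex) \<Rightarrow> ('g \<Rightarrow> complex)" where
  "rreg G g f = (\<lambda>x. if x \<in> carrier G then f (x \<otimes>\<^bsub>G\<^esub> g) else 0)"

lemma (in group) rreg_ket:
  assumes "g \<in> carrier G" "x \<in> carrier G"
  shows "rreg G g (ket x) = ket (x \<otimes> inv g)"
  using assms by (auto simp: rreg_def ket_def fun_eq_iff inv_solve_right m_assoc)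

definition scalar_walk ::
  "('g, 'b) monoid_scheme \<Rightarrow> 'g set \<Rightarrow> ('g \<Rightarrow> complex) \<Rightarrow> (('g \<Rightarrow> complex) \<Rightarrow> ('g \<Rightarrow> complex)) \<Rightarrow> bool"
where
  "scalar_walk G S z A \<longleftrightarrow>
     finite S \<and> S \<subseteq> carrier G \<and> generate G S = carrier G \<and>
     (\<forall>h\<in>S. z h \<noteq> 0) \<and>
     A = restrict (\<lambda>f x. \<Sum>h\<in>S. z h * rreg G h f x) (l2 (carrier G)) \<and>
     unitary_op (carrier G) A"


subsection \<open>Walks on a cyclic group with a two-dimensional coin\<close>

text \<open>
  For a group G, the tensor product of the Hilbert space over G with \<open>\<complex>\<^sup>2\<close> is
  \<open>l2 (carrier G \<times> UNIV)\<close>, where the second index has the two-element type \<open>2\<close>; the vector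
  \<open>|x\<rangle>|j\<rangle>\<close> is \<open>ket (x, j)\<close>. The following is the operator \<open>T\<^sub>g \<otimes> M\<close>.
\<close>

definition rreg_tensor ::
  "('g, 'b) monoid_scheme \<Rightarrow> 'g \<Rightarrow> complex^2^2 \<Rightarrow> ('g \<times> 2 \<Rightarrow> complex) \<Rightarrow> ('g \<times> 2 \<Rightarrow> complex)"
where
  "rreg_tensor G g M \<psi> = (\<lambda>(x, i). \<Sum>j\<in>UNIV. M $ i $ j * rreg G g (\<lambda>y. \<psi> (y, j)) x)"

definition coin_walk_op ::
  "('g, 'b) monoid_scheme \<Rightarrow> 'g \<Rightarrow> complex^2^2 \<Rightarrow> complex^2^2 \<Rightarrow> complex^2^2 \<Rightarrow>
   ('g \<times> 2 \<Rightarrow> complex) \<Rightarrow> ('g \<times> 2 \<Rightarrow> complex)"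
where
  "coin_walk_op G g Ap Am Ae = restrict
     (\<lambda>\<psi> x. rreg_tensor G g Ap \<psi> x + rreg_tensor G (inv\<^bsub>G\<^esub> g) Am \<psi> x
           + rreg_tensor G \<one>\<^bsub>G\<^esub> Ae \<psi> x)
     (l2 (carrier G \<times> UNIV))"

definition walk_symbol ::
  "complex^2^2 \<Rightarrow> complex^2^2 \<Rightarrow> complex^2^2 \<Rightarrow> real \<Rightarrow> complex^2^2"
where
  "walk_symbol Ap Am Ae k =
     (\<chi> i j. exp (- (\<i> * of_real k)) * Ap $ i $ j + exp (\<i> * of_real k) * Am $ i $ j + Ae $ i $ j)"


subsection \<open>The infinite dihedral group\<close>

text \<open>The pair \<open>(m, s)\<close> stands for \<open>a\<^sup>m r\<^sup>s\<close>.\<close>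

definition Dinf :: "(int \<times> bool) monoid" where
  "Dinf = \<lparr>carrier = UNIV,
           monoid.mult = (\<lambda>(m, s) (n, t). (m + (if s then - n else n), s \<noteq> t)),
           one = (0, False)\<rparr>"

definition rot :: "int \<times> bool" where
  "rot = (1, False)"

definition refl_elt :: "int \<times> bool" where
  "refl_elt = (0, True)"

definition Hrot :: "(int \<times> bool) set" where
  "Hrot = generate Dinf {rot}"

lemma Dinf_simps [simp]:
  "carrier Dinf = UNIV"
  "\<one>\<^bsub>Dinf\<^esub> = (0, False)"
  "(m, s) \<otimes>\<^bsub>Dinf\<^esub> (n, t) = (m + (if s then - n else n), s \<noteq> t)"
  by (simp_all add: Dinf_def)

lemma group_Dinf: "group Dinf"
proof (rule groupI)
  fix x assume "x \<in> carrier Dinf"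
  show "\<exists>y\<in>carrier Dinf. y \<otimes>\<^bsub>Dinf\<^esub> x = \<one>\<^bsub>Dinf\<^esub>"
    by (cases x, rule bexI[of _ "(if snd x then fst x else - fst x, snd x)"]) auto
qed (auto split: if_splits)

lemma inv_Dinf [simp]: "inv\<^bsub>Dinf\<^esub> (m, s) = (if s then m else - m, s)"
  by (rule group.inv_equality[OF group_Dinf]) auto

lemma Dinf_relations:
  "refl_elt \<otimes>\<^bsub>Dinf\<^esub> refl_elt = \<one>\<^bsub>Dinf\<^esub>"
  "refl_elt \<otimes>\<^bsub>Dinf\<^esub> rot \<otimes>\<^bsub>Dinf\<^esub> inv\<^bsub>Dinf\<^esub> refl_elt \<otimes>\<^bsub>Dinf\<^esub> rot = \<one>\<^bsub>Dinf\<^esub>"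
  by (simp_all add: refl_elt_def rot_def)

lemma rot_int_pow: "rot [^]\<^bsub>Dinf\<^esub> (m::int) = (m, False)"
proof -
  have n: "rot [^]\<^bsub>Dinf\<^esub> (n::nat) = (int n, False)" for n
    by (induction n) (simp_all add: rot_def)
  show ?thesis
    by (cases m rule: int_cases2) (simp_all add: group.int_pow_neg[OF group_Dinf] int_pow_int n)
qed

lemma Dinf_normal_form:
  "(m, s) = rot [^]\<^bsub>Dinf\<^esub> m \<otimes>\<^bsub>Dinf\<^esub> (if s then refl_elt else \<one>\<^bsub>Dinf\<^esub>)"
  by (simp add: rot_int_pow refl_elt_def)

lemma Hrot_eq: "Hrot = {(m, False) | m. True}"
  by (auto simp: Hrot_def group.generate_pow[OF group_Dinf] rot_int_pow)


subsection \<open>Coarse-graining\<close>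

definition coset_reps :: "(2 \<Rightarrow> int \<times> bool) \<Rightarrow> bool" where
  "coset_reps c \<longleftrightarrow> c 1 \<in> Hrot \<and> c 2 \<in> Hrot #>\<^bsub>Dinf\<^esub> refl_elt"

definition U_H :: "(2 \<Rightarrow> int \<times> bool) \<Rightarrow> (int \<times> bool \<Rightarrow> complex) \<Rightarrow> ((int \<times> bool) \<times> 2 \<Rightarrow> complex)" where
  "U_H c f = (\<lambda>(x, j). if x \<in> Hrot then f (x \<otimes>\<^bsub>Dinf\<^esub> c j) else 0)"

lemma coset_reps_bij:
  assumes "coset_reps c"
  shows "bij_betw (\<lambda>(x, j). x \<otimes>\<^bsub>Dinf\<^esub> c j) (Hrot \<times> UNIV) UNIV"
proof -
  obtain p q where c: "c 1 = (p, False)" "c 2 = (q, True)"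
    using assms by (auto simp: coset_reps_def Hrot_eq r_coset_def refl_elt_def)
  show ?thesis
    by (rule bij_betw_byWitness[where
          f' = "\<lambda>(m, s). if s then ((m - q, False), 2) else ((m - p, False), 1)"])
       (auto simp: c Hrot_eq forall_2 split: if_splits)
qed

lemma U_H_ket:
  assumes c: "coset_reps c" and x: "x \<in> Hrot"
  shows "U_H c (ket (x \<otimes>\<^bsub>Dinf\<^esub> c j)) = ket (x, j)"
proof -
  have "y \<otimes>\<^bsub>Dinf\<^esub> c i = x \<otimes>\<^bsub>Dinf\<^esub> c j \<longleftrightarrow> y = x \<and> i = j" if "y \<in> Hrot" for y i
    using coset_reps_bij[OF c] x that by (auto simp: bij_betw_def inj_on_def)
  then show ?thesis
    using x by (auto simp: U_H_def ket_def fun_eq_iff)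
qed

lemma U_H_bij:
  assumes c: "coset_reps c"
  shows "bij_betw (U_H c) (l2 UNIV) (l2 (Hrot \<times> UNIV))"
proof -
  let ?e = "\<lambda>(x, j). x \<otimes>\<^bsub>Dinf\<^esub> c j"
  let ?X = "Hrot \<times> (UNIV :: 2 set)"
  note e = coset_reps_bij[OF c]
  have U: "U_H c f p = (if p \<in> ?X then f (?e p) else 0)" for f p
    by (cases p) (simp add: U_H_def)
  have inv: "inv_into ?X ?e y \<in> ?X" "?e (inv_into ?X ?e y) = y" for y
    using e by (metis (no_types, lifting) UNIV_I bij_betw_def inv_into_into f_inv_into_f)+
  have norm: "(\<lambda>p. (cmod (U_H c f p))\<^sup>2) summable_on ?X \<longleftrightarrow> (\<lambda>x. (cmod (f x))\<^sup>2) summable_on UNIV"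
    for f
    unfolding summable_on_reindex_bij_betw[OF e, symmetric]
    by (rule summable_on_cong) (auto simp: U)
  have "inj_on (U_H c) (l2 UNIV)"
  proof (intro inj_onI ext)
    fix f g y assume "U_H c f = U_H c g"
    from fun_cong[OF this, of "inv_into ?X ?e y"] show "f y = g y"
      using inv[of y] by (simp add: U del: mem_Times_iff)
  qed
  moreover have "U_H c ` l2 UNIV = l2 ?X"
  proof (intro equalityI subsetI)
    fix \<psi> assume "\<psi> \<in> U_H c ` l2 UNIV"
    then show "\<psi> \<in> l2 ?X" by (auto simp: l2_def norm) (auto simp: U_H_def)
  next
    fix \<psi> assume \<psi>: "\<psi> \<in> l2 ?X"
    have eq: "\<psi> = U_H c (\<lambda>y. \<psi> (inv_into ?X ?e y))"
    proof
      fix p show "\<psi> p = U_H c (\<lambda>y. \<psi> (inv_into ?X ?e y)) p"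
      proof (cases "p \<in> ?X")
        case True
        then have "inv_into ?X ?e (?e p) = p" using e by (intro inv_into_f_f) (auto simp: bij_betw_def)
        then show ?thesis unfolding U using True by (simp del: mem_Times_iff)
      next
        case False
        then show ?thesis unfolding U using \<psi> unfolding l2_def by (simp only: mem_Collect_eq if_False) blast
      qed
    qed
    have "(\<lambda>y. \<psi> (inv_into ?X ?e y)) \<in> l2 UNIV"
      using \<psi> by (simp add: l2_def norm[symmetric] eq[symmetric])
    with eq show "\<psi> \<in> U_H c ` l2 UNIV" by blast
  qed
  ultimately show ?thesis by (simp add: bij_betw_def)
qed

text \<open>As \<open>U_H c\<close> is unitary, its adjoint is written as its inverse.\<close>

definition coarse_graining ::
  "(2 \<Rightarrow> int \<times> bool) \<Rightarrow> ((int \<times> bool \<Rightarrow> complex) \<Rightarrow> (int \<times> bool \<Rightarrow> complex)) \<Rightarrow>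
   ((int \<times> bool) \<times> 2 \<Rightarrow> complex) \<Rightarrow> ((int \<times> bool) \<times> 2 \<Rightarrow> complex)"
where
  "coarse_graining c A = restrict (\<lambda>\<psi>. U_H c (A (inv_into (l2 UNIV) (U_H c) \<psi>))) (l2 (Hrot \<times> UNIV))"

definition coset_tau :: "(2 \<Rightarrow> int \<times> bool) \<Rightarrow> int \<times> bool \<Rightarrow> 2 \<Rightarrow> 2" where
  "coset_tau c h j = (THE i. c j \<otimes>\<^bsub>Dinf\<^esub> inv\<^bsub>Dinf\<^esub> h \<in> Hrot #>\<^bsub>Dinf\<^esub> c i)"

definition coordination_two :: "(2 \<Rightarrow> int \<times> bool) \<Rightarrow> (int \<times> bool) set \<Rightarrow> bool" where
  "coordination_two c S \<longleftrightarrow>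
     (\<forall>h\<in>S. \<forall>j. c (coset_tau c h j) \<otimes>\<^bsub>Dinf\<^esub> h \<otimes>\<^bsub>Dinf\<^esub> inv\<^bsub>Dinf\<^esub> (c j)
        \<in> {\<one>\<^bsub>Dinf\<^esub>, rot, inv\<^bsub>Dinf\<^esub> rot})"

definition is_coarse_grained ::
  "complex^2^2 \<Rightarrow> complex^2^2 \<Rightarrow> complex^2^2 \<Rightarrow> bool"
where
  "is_coarse_grained Ap Am Ae \<longleftrightarrow>
     (\<exists>S z A c. scalar_walk Dinf S z A \<and> coset_reps c \<and> coordination_two c S \<and>
        coarse_graining c A = coin_walk_op (Dinf\<lparr>carrier := Hrot\<rparr>) rot Ap Am Ae)"


subsection \<open>The two classes of walks\<close>

text \<open>
  Both classes consist of operators on the Hilbert space over the integers tensored with \<open>\<complex>\<^sup>2\<close>;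
  a coarse-grained walk, which lives over the subgroup \<open>Hrot\<close>, is transported there through its
  symbol. Nonvanishing of the coefficients of the shifts and unitarity are not imposed in
  \<open>W_CG\<close>.
\<close>

abbreviation Z_walk_op ::
  "complex^2^2 \<Rightarrow> complex^2^2 \<Rightarrow> complex^2^2 \<Rightarrow> (int \<times> 2 \<Rightarrow> complex) \<Rightarrow> (int \<times> 2 \<Rightarrow> complex)"
where
  "Z_walk_op \<equiv> coin_walk_op integer_group 1"

definition W_CG :: "((int \<times> 2 \<Rightarrow> complex) \<Rightarrow> (int \<times> 2 \<Rightarrow> complex)) set" where
  "W_CG = {W. \<exists>Bp Bm Be Ap Am Ae U.
      W = Z_walk_op Bp Bm Be \<and>
      is_coarse_grained Ap Am Ae \<and> unitary_matrix U \<and>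
      (\<forall>k\<in>{-pi..pi}. walk_symbol Bp Bm Be k = U ** walk_symbol Ap Am Ae k ** dagger U)}"

definition W_P :: "((int \<times> 2 \<Rightarrow> complex) \<Rightarrow> (int \<times> 2 \<Rightarrow> complex)) set" where
  "W_P = {W. \<exists>Ap Am Ae P.
      W = Z_walk_op Ap Am Ae \<and> Ap \<noteq> 0 \<and> Am \<noteq> 0 \<and>
      unitary_op (UNIV \<times> UNIV) W \<and>
      P = dagger P \<and> P ** P = mat 1 \<and> P \<noteq> mat 1 \<and>
      (\<forall>k\<in>{-pi..pi}. P ** walk_symbol Ap Am Ae k ** dagger P = walk_symbol Ap Am Ae (- k))}"

end

theory Submission
  imports Defs
begin

text \<open>
  Write \<open>flip\<close> for the matrix exchanging the two basis vectors. The coefficients of a coarse-grained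
  walk satisfy \<open>Am = flip Ap flip\<close> and \<open>Ae = flip Ae flip\<close>, because conjugation by a reflection
  inverts the rotations. Conversely, any walk with these symmetries comes from a scalar walk whose
  amplitudes are the entries of the first rows; only the generation of the dihedral group is in
  question. It holds once \<open>Ap\<close> has a nonzero entry both on and off the diagonal, which a suitable
  change of basis commuting with \<open>flip\<close> achieves unless \<open>Ap = Am\<close>. That case, and with it
  \<open>P = - 1\<close>, is excluded by unitarity.
\<close>

section \<open>Isometries between spaces of square-summable functions\<close>

text \<open>The clauses of \<open>unitary_op\<close> with source and target separated;
  \<open>unitary_op\<close> is the case of equal index sets. Every relabelling and change of basis
  below is such a map, so unitarity can be moved along it.\<close>

definition l2_iso :: "'i set \<Rightarrow> 'j set \<Rightarrow> (('i \<Rightarrow> complex) \<Rightarrow> ('j \<Rightarrow> complex)) \<Rightarrow> bool" where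
  "l2_iso X Y \<Phi> \<longleftrightarrow>
     \<Phi> ` l2 X = l2 Y \<and>
     (\<forall>f\<in>l2 X. \<forall>g\<in>l2 X. \<forall>\<alpha> \<beta>.
        \<Phi> (\<lambda>x. \<alpha> * f x + \<beta> * g x) = (\<lambda>x. \<alpha> * \<Phi> f x + \<beta> * \<Phi> g x)) \<and>
     (\<forall>f\<in>l2 X. \<forall>g\<in>l2 X. l2_inner Y (\<Phi> f) (\<Phi> g) = l2_inner X f g)"

text \<open>Comparison through |u + v|^2 \<le> 2 |u|^2 + 2 |v|^2.\<close>

lemma l2_combination:
  assumes "f \<in> l2 X" "g \<in> l2 X"
  shows "(\<lambda>x. \<alpha> * f x + \<beta> * g x) \<in> l2 X"
proof -
  have le: "(cmod (\<alpha> * f x + \<beta> * g x))\<^sup>2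
      \<le> 2 * (cmod \<alpha>)\<^sup>2 * (cmod (f x))\<^sup>2 + 2 * (cmod \<beta>)\<^sup>2 * (cmod (g x))\<^sup>2" for x
  proof -
    have "(cmod (\<alpha> * f x + \<beta> * g x))\<^sup>2 \<le> (cmod (\<alpha> * f x) + cmod (\<beta> * g x))\<^sup>2"
      by (intro power_mono norm_triangle_ineq) auto
    also have "\<dots> \<le> 2 * (cmod (\<alpha> * f x))\<^sup>2 + 2 * (cmod (\<beta> * g x))\<^sup>2"
      using sum_squares_bound[of "cmod (\<alpha> * f x)" "cmod (\<beta> * g x)"]
      by (simp add: power2_sum)
    finally show ?thesis by (simp add: norm_mult power_mult_distrib)
  qed
  have "(\<lambda>x. 2 * (cmod \<alpha>)\<^sup>2 * (cmod (f x))\<^sup>2 + 2 * (cmod \<beta>)\<^sup>2 * (cmod (g x))\<^sup>2) summable_on X"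
    by (rule summable_on_add; rule summable_on_cmult_right) (use assms in \<open>auto simp: l2_def\<close>)
  then have "(\<lambda>x. (cmod (\<alpha> * f x + \<beta> * g x))\<^sup>2) summable_on X"
    by (rule summable_on_comparison_test) (auto simp: le)
  with assms show ?thesis by (auto simp: l2_def)
qed

lemma l2_inner_summable:
  assumes "f \<in> l2 X" "g \<in> l2 X"
  shows "(\<lambda>x. cnj (f x) * g x) summable_on X"
proof -
  have "(\<lambda>x. norm (cnj (f x) * g x)) summable_on X"
    by (rule abs_summable_product)
       (use assms in \<open>auto simp: l2_def norm_mult power2_eq_square\<close>)
  then show ?thesis by (rule abs_summable_summable)
qed

lemma ket_in_l2: "x \<in> X \<Longrightarrow> ket x \<in> l2 X"
  unfolding l2_def ket_def
  by (auto intro!: finite_nonzero_values_imp_summable_on finite_subset[of _ "{x}"] split: if_splits)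

text \<open>On \<open>l2 Y\<close> the operator \<open>W\<close> is the conjugate of
  \<open>V\<close> by \<open>\<Phi>\<close>. As \<open>\<Phi>\<close> is onto, surjectivity,
  linearity and isometry of \<open>W\<close> need only be tested on images under
  \<open>\<Phi>\<close>.\<close>

lemma unitary_op_transport:
  assumes \<Phi>: "l2_iso X Y \<Phi>" and V: "unitary_op X V"
    and eq: "\<And>f. f \<in> l2 X \<Longrightarrow> W (\<Phi> f) = \<Phi> (V f)"
  shows "unitary_op Y W"
proof -
  have Vl: "V f \<in> l2 X" if "f \<in> l2 X" for f
    using V that by (auto simp: unitary_op_def)
  have "W ` l2 Y = W ` \<Phi> ` l2 X"
    using \<Phi> by (simp add: l2_iso_def)
  also have "\<dots> = \<Phi> ` V ` l2 X"
    using eq by (auto simp: image_image)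
  also have "\<dots> = l2 Y"
    using \<Phi> V by (simp add: l2_iso_def unitary_op_def)
  finally have img: "W ` l2 Y = l2 Y" .
  have pre: "\<exists>f'\<in>l2 X. f = \<Phi> f'" if "f \<in> l2 Y" for f
    using \<Phi> that by (auto simp: l2_iso_def)
  have lin: "W (\<lambda>x. \<alpha> * f x + \<beta> * g x) = (\<lambda>x. \<alpha> * W f x + \<beta> * W g x)"
    if "f \<in> l2 Y" "g \<in> l2 Y" for f g \<alpha> \<beta>
  proof -
    obtain f' g' where f': "f' \<in> l2 X" "f = \<Phi> f'" and g': "g' \<in> l2 X" "g = \<Phi> g'"
      using pre \<open>f \<in> l2 Y\<close> \<open>g \<in> l2 Y\<close> by blast
    have "W (\<lambda>x. \<alpha> * f x + \<beta> * g x) = W (\<Phi> (\<lambda>x. \<alpha> * f' x + \<beta> * g' x))"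
      using \<Phi> f' g' by (simp add: l2_iso_def)
    also have "\<dots> = \<Phi> (V (\<lambda>x. \<alpha> * f' x + \<beta> * g' x))"
      using f' g' by (intro eq l2_combination)
    also have "\<dots> = \<Phi> (\<lambda>x. \<alpha> * V f' x + \<beta> * V g' x)"
      using V f' g' by (simp add: unitary_op_def)
    also have "\<dots> = (\<lambda>x. \<alpha> * \<Phi> (V f') x + \<beta> * \<Phi> (V g') x)"
      using \<Phi> f' g' Vl by (simp add: l2_iso_def)
    finally show ?thesis
      using f' g' by (simp add: eq)
  qed
  have "l2_inner Y (W f) (W g) = l2_inner Y f g" if "f \<in> l2 Y" "g \<in> l2 Y" for f g
  proof -
    obtain f' g' where f': "f' \<in> l2 X" "f = \<Phi> f'" and g': "g' \<in> l2 X" "g = \<Phi> g'"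
      using pre \<open>f \<in> l2 Y\<close> \<open>g \<in> l2 Y\<close> by blast
    have "l2_inner Y (W f) (W g) = l2_inner Y (\<Phi> (V f')) (\<Phi> (V g'))"
      using f' g' by (simp add: eq)
    also have "\<dots> = l2_inner X (V f') (V g')"
      using \<Phi> f' g' Vl by (simp add: l2_iso_def)
    also have "\<dots> = l2_inner X f' g'"
      using V f' g' by (simp add: unitary_op_def)
    also have "\<dots> = l2_inner Y f g"
      using \<Phi> f' g' by (simp add: l2_iso_def)
    finally show ?thesis .
  qed
  with img lin show ?thesis by (simp add: unitary_op_def)
qed

section \<open>Relabelling of basis states along a bijection\<close>

definition reindex :: "'j set \<Rightarrow> ('j \<Rightarrow> 'i) \<Rightarrow> ('i \<Rightarrow> complex) \<Rightarrow> ('j \<Rightarrow> complex)" where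
  "reindex Y e f = (\<lambda>y. if y \<in> Y then f (e y) else 0)"

lemma reindex_in_l2:
  assumes e: "bij_betw e Y X" and f: "f \<in> l2 X"
  shows "reindex Y e f \<in> l2 Y"
proof -
  have "(\<lambda>y. (cmod (f (e y)))\<^sup>2) summable_on Y"
    using f summable_on_reindex_bij_betw[OF e, of "\<lambda>x. (cmod (f x))\<^sup>2"]
    by (auto simp: l2_def)
  then have "(\<lambda>y. (cmod (reindex Y e f y))\<^sup>2) summable_on Y"
    by (rule summable_on_cong[THEN iffD1, rotated]) (simp add: reindex_def)
  then show ?thesis by (simp add: l2_def reindex_def)
qed

lemma l2_iso_reindex:
  assumes e: "bij_betw e Y X"
  shows "l2_iso X Y (reindex Y e)"
proof -
  let ?e' = "inv_into Y e"
  have e': "bij_betw ?e' X Y" using e by (rule bij_betw_inv_into)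
  have "reindex Y e ` l2 X = l2 Y"
  proof (intro equalityI subsetI)
    fix \<psi> assume \<psi>: "\<psi> \<in> l2 Y"
    have "\<psi> = reindex Y e (reindex X ?e' \<psi>)"
      using \<psi> e bij_betwE[OF e]
      by (auto simp: reindex_def fun_eq_iff l2_def bij_betw_inv_into_left)
    then show "\<psi> \<in> reindex Y e ` l2 X"
      using reindex_in_l2[OF e' \<psi>] by blast
  qed (use reindex_in_l2[OF e] in blast)
  moreover have "l2_inner Y (reindex Y e f) (reindex Y e g) = l2_inner X f g" for f g
  proof -
    have "l2_inner Y (reindex Y e f) (reindex Y e g) = (\<Sum>\<^sub>\<infinity>y\<in>Y. cnj (f (e y)) * g (e y))"
      unfolding l2_inner_def by (rule infsum_cong) (simp add: reindex_def)
    also have "\<dots> = l2_inner X f g"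
      unfolding l2_inner_def using infsum_reindex_bij_betw[OF e] .
    finally show ?thesis .
  qed
  ultimately show ?thesis
    by (auto simp: l2_iso_def reindex_def fun_eq_iff)
qed

section \<open>Matrices acting on the second tensor factor\<close>

definition coin :: "complex^2^2 \<Rightarrow> ('x \<times> 2 \<Rightarrow> complex) \<Rightarrow> ('x \<times> 2 \<Rightarrow> complex)" where
  "coin U \<psi> = (\<lambda>(x, i). \<Sum>j\<in>UNIV. U $ i $ j * \<psi> (x, j))"

lemma summable_on_Times_2:
  fixes f :: "'x \<times> 2 \<Rightarrow> 'b :: banach"
  assumes "\<And>j. (\<lambda>x. f (x, j)) summable_on X"
  shows "f summable_on X \<times> UNIV"
proof -
  have s: "f summable_on X \<times> {j}" for j
  proof -
    have "bij_betw (\<lambda>x. (x, j)) X (X \<times> {j})"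
      by (rule bij_betw_byWitness[where f' = fst]) auto
    from summable_on_reindex_bij_betw[OF this, of f] assms[of j]
    show ?thesis by simp
  qed
  have "X \<times> UNIV = X \<times> {1} \<union> X \<times> {2::2}"
    by (auto simp: UNIV_2)
  then show ?thesis
    using summable_on_Un_disjoint[OF s s, of 1 2] by (simp add: Times_Int_distrib1 disjoint_iff)
qed

lemma component_in_l2:
  assumes "\<psi> \<in> l2 (X \<times> UNIV)"
  shows "(\<lambda>x. \<psi> (x, j)) \<in> l2 X"
proof -
  have bij: "bij_betw (\<lambda>x. (x, j)) X (X \<times> {j})"
    by (rule bij_betw_byWitness[where f' = fst]) auto
  have "(\<lambda>p. (cmod (\<psi> p))\<^sup>2) summable_on (X \<times> {j})"
    by (rule summable_on_subset_banach[where A = "X \<times> UNIV"]) (use assms in \<open>auto simp: l2_def\<close>)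
  then have "(\<lambda>x. (cmod (\<psi> (x, j)))\<^sup>2) summable_on X"
    by (rule summable_on_reindex_bij_betw[OF bij, THEN iffD2])
  moreover have "\<psi> (x, j) = 0" if "x \<notin> X" for x
    using assms that by (simp add: l2_def)
  ultimately show ?thesis by (simp add: l2_def)
qed

lemma coin_in_l2:
  assumes "\<psi> \<in> l2 (X \<times> UNIV)"
  shows "coin U \<psi> \<in> l2 (X \<times> UNIV)"
proof -
  have "(\<lambda>x. coin U \<psi> (x, i)) \<in> l2 X" for i
    using l2_combination[OF component_in_l2[OF assms] component_in_l2[OF assms],
        of "U $ i $ 1" 1 "U $ i $ 2" 2]
    by (simp add: coin_def sum_2)
  then have "(\<lambda>p. (cmod (coin U \<psi> p))\<^sup>2) summable_on X \<times> UNIV"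
    by (intro summable_on_Times_2) (simp add: l2_def)
  then show ?thesis
    using assms by (auto simp: l2_def coin_def sum_2)
qed

lemma l2_inner_Times:
  assumes "\<psi> \<in> l2 (X \<times> (UNIV :: 2 set))" "\<phi> \<in> l2 (X \<times> UNIV)"
  shows "l2_inner (X \<times> UNIV) \<psi> \<phi> = (\<Sum>\<^sub>\<infinity>x\<in>X. \<Sum>i\<in>UNIV. cnj (\<psi> (x, i)) * \<phi> (x, i))"
  using infsum_Sigma'_banach[of "\<lambda>x i. cnj (\<psi> (x, i)) * \<phi> (x, i)" X "\<lambda>_. UNIV"]
    l2_inner_summable[OF assms]
  by (simp add: l2_inner_def case_prod_unfold)

lemmas mat_simps = vec_eq_iff forall_2 matrix_matrix_mult_def sum_2 dagger_def mat_def

lemma dagger_dagger [simp]: "dagger (dagger M) = M"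
  by (simp add: dagger_def vec_eq_iff)

lemma dagger_mult: "dagger (M ** N) = dagger N ** dagger M"
  by (simp add: mat_simps mult.commute)

lemma unitary_matrix_dagger: "unitary_matrix U \<Longrightarrow> unitary_matrix (dagger U)"
  by (simp add: unitary_matrix_def)

lemma unitary_matrix_mult:
  assumes "unitary_matrix U" "unitary_matrix V"
  shows "unitary_matrix (U ** V)"
proof -
  have "U ** V ** (dagger V ** dagger U) = U ** (V ** dagger V) ** dagger U"
    by (simp only: matrix_mul_assoc)
  moreover have "dagger V ** dagger U ** (U ** V) = dagger V ** (dagger U ** U) ** V"
    by (simp only: matrix_mul_assoc)
  ultimately show ?thesis
    using assms by (simp add: unitary_matrix_def dagger_mult)
qed

lemma coin_mult: "coin U (coin V \<psi>) = coin (U ** V) \<psi>"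
  by (auto simp: coin_def fun_eq_iff matrix_matrix_mult_def sum_2 algebra_simps)

lemma coin_one [simp]: "coin (mat 1) \<psi> = \<psi>"
  by (auto simp: coin_def fun_eq_iff mat_def sum_2 forall_2)

text \<open>The matrix acts separately at each site: \<open>coin (dagger U)\<close> is the inverse,
  and the inner product is preserved already in the sum over the two coin indices at a fixed
  site.\<close>

lemma l2_iso_coin:
  assumes U: "unitary_matrix U"
  shows "l2_iso (X \<times> UNIV) (X \<times> UNIV) (coin U)"
proof -
  have "coin U ` l2 (X \<times> UNIV) = l2 (X \<times> UNIV)"
  proof (intro equalityI subsetI)
    fix \<psi> :: "'a \<times> 2 \<Rightarrow> complex" assume \<psi>: "\<psi> \<in> l2 (X \<times> UNIV)"
    have "\<psi> = coin U (coin (dagger U) \<psi>)"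
      using U by (simp add: coin_mult unitary_matrix_def)
    then show "\<psi> \<in> coin U ` l2 (X \<times> UNIV)"
      using coin_in_l2[OF \<psi>] by blast
  qed (use coin_in_l2 in blast)
  moreover have "l2_inner (X \<times> UNIV) (coin U \<psi>) (coin U \<phi>) = l2_inner (X \<times> UNIV) \<psi> \<phi>"
    if "\<psi> \<in> l2 (X \<times> UNIV)" "\<phi> \<in> l2 (X \<times> UNIV)" for \<psi> \<phi>
  proof -
    have "(\<Sum>i\<in>UNIV. cnj (coin U \<psi> (x, i)) * coin U \<phi> (x, i))
        = (\<Sum>i\<in>UNIV. \<Sum>j\<in>UNIV. (dagger U ** U) $ i $ j * cnj (\<psi> (x, i)) * \<phi> (x, j))" for x
      by (simp add: coin_def matrix_matrix_mult_def dagger_def sum_2 algebra_simps)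
    then have "(\<Sum>i\<in>UNIV. cnj (coin U \<psi> (x, i)) * coin U \<phi> (x, i))
        = (\<Sum>i\<in>UNIV. cnj (\<psi> (x, i)) * \<phi> (x, i))" for x
      using U by (simp add: unitary_matrix_def mat_def sum_2)
    with that show ?thesis by (simp add: l2_inner_Times coin_in_l2)
  qed
  ultimately show ?thesis
    by (auto simp: l2_iso_def coin_def fun_eq_iff sum_2 algebra_simps)
qed


section \<open>Walks on the line and their symbols\<close>

lemma walk_symbol_minus: "walk_symbol Ap Am Ae (- k) = walk_symbol Am Ap Ae k"
  by (simp add: walk_symbol_def vec_eq_iff)

lemma walk_symbol_conj:
  "U ** walk_symbol Ap Am Ae k ** V = walk_symbol (U ** Ap ** V) (U ** Am ** V) (U ** Ae ** V) k"
  by (simp add: walk_symbol_def matrix_matrix_mult_def vec_eq_iff sum_distrib_left sum_distrib_right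
      sum.distrib distrib_left distrib_right mult_ac)

text \<open>The functions exp(-ik), exp(ik) and 1 are linearly independent; the samples at 0, pi and
  pi/2 already show it. Thus identities between symbols become identities between coefficient
  matrices.\<close>

lemma walk_symbol_inject:
  "(\<forall>k\<in>{-pi..pi}. walk_symbol Ap Am Ae k = walk_symbol Bp Bm Be k)
     \<longleftrightarrow> Ap = Bp \<and> Am = Bm \<and> Ae = Be" (is "?L \<longleftrightarrow> ?R")
proof
  assume L: ?L
  have e: "exp (\<i> * complex_of_real (pi / 2)) = \<i>" "exp (- (\<i> * complex_of_real (pi / 2))) = - \<i>"
    "exp (\<i> * complex_of_real pi) = - 1" "exp (- (\<i> * complex_of_real pi)) = - 1"
    using cis_conv_exp[of "pi/2"] cis_conv_exp[of "-(pi/2)"] cis_conv_exp[of pi] cis_conv_exp[of "-pi"]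
    by (simp_all add: cis.code Complex_eq del: of_real_divide)
  show ?R
  proof -
    have eqs: "Ap $ i $ j = Bp $ i $ j \<and> Am $ i $ j = Bm $ i $ j \<and> Ae $ i $ j = Be $ i $ j" for i j
    proof -
      define p m d where "p = Ap $ i $ j - Bp $ i $ j" and "m = Am $ i $ j - Bm $ i $ j"
        and "d = Ae $ i $ j - Be $ i $ j"
      have z: "exp (- (\<i> * of_real k)) * p + exp (\<i> * of_real k) * m + d = 0" if "k \<in> {-pi..pi}" for k
      proof -
        have "walk_symbol Ap Am Ae k $ i $ j = walk_symbol Bp Bm Be k $ i $ j"
          using L that by simp
        then show ?thesis
          by (simp add: walk_symbol_def p_def m_def d_def algebra_simps)
      qed
      have 1: "p + m + d = 0" using z[of 0] by simp
      have 2: "- p - m + d = 0" using z[of pi] by (simp add: e)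
      have 3: "- \<i> * p + \<i> * m + d = 0" using z[of "pi/2"] e by (simp del: of_real_divide)
      have d: "d = 0" using arg_cong2[OF 1 2, of "(+)"] by simp
      have "m = p" using 3 unfolding d
        by (metis (no_types, opaque_lifting) add.commute add.right_neutral complex_i_not_zero
            eq_neg_iff_add_eq_0 minus_mult_left minus_minus mult_cancel_left)
      then have "p = 0" "m = 0" using 1 d by (simp_all flip: mult_2)
      with d show ?thesis by (simp add: p_def m_def d_def)
    qed
    then show ?R by (simp add: vec_eq_iff)
  qed
qed simp

text \<open>\<open>rreg\<close> evaluates its argument at x g, so \<open>Ap\<close> reads the value
  at \<open>m + 1\<close>, that is, it moves a localised state one site to the left.\<close>

lemma Z_walk_apply:
  assumes "\<psi> \<in> l2 UNIV"
  shows "Z_walk_op Ap Am Ae \<psi> (m, i) =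
    coin Ap \<psi> (m + 1, i) + coin Am \<psi> (m - 1, i) + coin Ae \<psi> (m, i)"
  using assms by (simp add: coin_walk_op_def rreg_tensor_def rreg_def coin_def)

text \<open>Coin matrices commute with translations, so conjugating the walk by
  \<open>coin U\<close> conjugates each of the three coefficients by \<open>U\<close>.\<close>

lemma Z_walk_conj_unitary:
  assumes U: "unitary_matrix U" and W: "unitary_op UNIV (Z_walk_op Ap Am Ae)"
  shows "unitary_op UNIV
    (Z_walk_op (U ** Ap ** dagger U) (U ** Am ** dagger U) (U ** Ae ** dagger U))"
proof (rule unitary_op_transport[OF _ W])
  have "l2_iso (UNIV \<times> UNIV) (UNIV \<times> UNIV) (coin U :: (int \<times> 2 \<Rightarrow> complex) \<Rightarrow> _)"
    using U by (rule l2_iso_coin)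
  then show "l2_iso UNIV UNIV (coin U :: (int \<times> 2 \<Rightarrow> complex) \<Rightarrow> _)" by simp
  fix \<psi> :: "int \<times> 2 \<Rightarrow> complex" assume \<psi>: "\<psi> \<in> l2 UNIV"
  have c\<psi>: "coin U \<psi> \<in> l2 UNIV"
    using coin_in_l2[of \<psi> UNIV U] \<psi> by simp
  have cc: "coin (U ** M ** dagger U) (coin U \<psi>) = coin U (coin M \<psi>)" for M
    using U by (simp add: coin_mult unitary_matrix_def flip: matrix_mul_assoc)
  have "coin U (Z_walk_op Ap Am Ae \<psi>) (m, i) =
      coin U (coin Ap \<psi>) (m + 1, i) + coin U (coin Am \<psi>) (m - 1, i) + coin U (coin Ae \<psi>) (m, i)"
    for m i
    by (simp add: coin_def[of U] Z_walk_apply[OF \<psi>] sum_2 algebra_simps)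
  then show "Z_walk_op (U ** Ap ** dagger U) (U ** Am ** dagger U) (U ** Ae ** dagger U) (coin U \<psi>)
     = coin U (Z_walk_op Ap Am Ae \<psi>)"
    by (auto simp: fun_eq_iff Z_walk_apply[OF c\<psi>] cc)
qed

lemma conj_cancel:
  assumes "unitary_matrix U"
  shows "dagger U ** (U ** M ** dagger U) ** U = M"
proof -
  have "dagger U ** (U ** M ** dagger U) ** U = (dagger U ** U) ** M ** (dagger U ** U)"
    by (simp only: matrix_mul_assoc)
  with assms show ?thesis by (simp add: unitary_matrix_def)
qed

lemma conj_mult:
  assumes "unitary_matrix U"
  shows "(U ** M ** dagger U) ** (U ** N ** dagger U) = U ** (M ** N) ** dagger U"
proof -
  have "(U ** M ** dagger U) ** (U ** N ** dagger U) = U ** M ** (dagger U ** U) ** N ** dagger U"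
    by (simp only: matrix_mul_assoc)
  with assms show ?thesis by (simp add: unitary_matrix_def matrix_mul_assoc)
qed

lemma coin_ket: "coin M (ket (x, j)) (y, i) = (if y = x then M $ i $ j else 0)"
  using exhaust_2[of j] by (auto simp: coin_def ket_def sum_2)

text \<open>Translates of a localised state by two sites overlap only through one hop to the left and
  one to the right, which forbids \<open>Ap = Am\<close>.\<close>

lemma Z_walk_hops_distinct:
  assumes W: "unitary_op UNIV (Z_walk_op Ap Am Ae)" and "Ap \<noteq> 0"
  shows "Ap \<noteq> Am"
proof
  assume eq: "Ap = Am"
  have "Ap $ i $ j = 0" for i j
  proof -
    let ?W = "Z_walk_op Ap Am Ae"
    let ?f = "ket (0, j) :: int \<times> 2 \<Rightarrow> complex" and ?g = "ket (2, j) :: int \<times> 2 \<Rightarrow> complex"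
    have l2: "?f \<in> l2 UNIV" "?g \<in> l2 UNIV" by (simp_all add: ket_in_l2)
    \<comment> \<open>The image of \<open>?f\<close> is supported on the sites -1, 0, 1 and that of
      \<open>?g\<close> on 1, 2, 3, so only site 1 contributes.\<close>
    have "l2_inner UNIV (?W ?f) (?W ?g) = (\<Sum>\<^sub>\<infinity>p\<in>{1} \<times> UNIV. cnj (?W ?f p) * ?W ?g p)"
      unfolding l2_inner_def
    proof (rule infsum_cong_neutral)
      fix p :: "int \<times> 2" assume p: "p \<in> UNIV - {1} \<times> UNIV"
      obtain m i where "p = (m, i)" by (cases p)
      with p show "cnj (?W ?f p) * ?W ?g p = 0"
        by (auto simp: Z_walk_apply[OF l2(1)] Z_walk_apply[OF l2(2)] coin_ket)
    qed auto
    also have "\<dots> = (\<Sum>i\<in>UNIV. cnj (?W ?f (1, i)) * ?W ?g (1, i))"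
    proof -
      have "{1} \<times> UNIV = {(1 :: int, 1 :: 2), (1, 2)}" by (auto simp: UNIV_2)
      then show ?thesis by (simp add: sum_2)
    qed
    \<comment> \<open>At site 1 the state \<open>?f\<close> arrives through \<open>Am\<close> and
      \<open>?g\<close> through \<open>Ap\<close>. As these agree, the inner product is the squared
      norm of column \<open>j\<close>.\<close>
    also have "\<dots> = (\<Sum>i\<in>UNIV. cnj (Ap $ i $ j) * Ap $ i $ j)"
      by (simp add: Z_walk_apply[OF l2(1)] Z_walk_apply[OF l2(2)] coin_ket eq)
    also have "\<dots> = of_real (\<Sum>i\<in>UNIV. (cmod (Ap $ i $ j))\<^sup>2)"
      by (simp add: sum_2 mult.commute[of "cnj _"] flip: complex_norm_square)
    finally have "of_real (\<Sum>i\<in>UNIV. (cmod (Ap $ i $ j))\<^sup>2) = l2_inner UNIV (?W ?f) (?W ?g)" ..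
    also have "\<dots> = l2_inner UNIV ?f ?g"
      using W l2 by (simp add: unitary_op_def)
    also have "\<dots> = 0"
      unfolding l2_inner_def by (rule infsum_0) (auto simp: ket_def)
    finally have "(\<Sum>i\<in>UNIV. (cmod (Ap $ i $ j))\<^sup>2) = 0"
      by (simp only: of_real_eq_0_iff)
    then show ?thesis
      by (simp add: sum_nonneg_eq_0_iff)
  qed
  with \<open>Ap \<noteq> 0\<close> show False by (simp add: vec_eq_iff)
qed


section \<open>Parity matrices\<close>

definition flip :: "complex^2^2" where
  "flip = (\<chi> i j. if i = j then 0 else 1)"

lemma flip_entries [simp]: "flip $ 1 $ 1 = 0" "flip $ 1 $ 2 = 1" "flip $ 2 $ 1 = 1" "flip $ 2 $ 2 = 0"
  by (simp_all add: flip_def)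

lemma flip_square [simp]: "flip ** flip = mat 1"
  by (simp add: mat_simps)

lemma dagger_flip [simp]: "dagger flip = flip"
  by (simp add: mat_simps)

lemma flip_conj_eq:
  "M = flip ** N ** flip \<longleftrightarrow>
    M $ 1 $ 1 = N $ 2 $ 2 \<and> M $ 1 $ 2 = N $ 2 $ 1 \<and> M $ 2 $ 1 = N $ 1 $ 2 \<and> M $ 2 $ 2 = N $ 1 $ 1"
  by (simp add: mat_simps)

lemma dagger_scaleR: "dagger (r *\<^sub>R M) = r *\<^sub>R dagger M"
  by (simp add: dagger_def vec_eq_iff)

text \<open>A reflection \<open>P\<close> of trace zero is turned into \<open>flip\<close> by the normalised sum \<open>P + flip\<close>,
  unless this sum vanishes.\<close>

lemma parity_conj_flip:
  assumes P: "P = dagger P" "P ** P = mat 1" "P \<noteq> mat 1" "P \<noteq> - mat 1"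
  obtains U where "unitary_matrix U" "U ** P ** dagger U = flip"
proof -
  define a b where "a = P $ 1 $ 1" and "b = P $ 1 $ 2"
  define d where "d = P $ 2 $ 2"
  have dP: "dagger P = P" using P(1) by (rule sym)
  have "cnj (P $ j $ i) = P $ i $ j" for i j
    using arg_cong[OF dP, of "\<lambda>M. M $ i $ j"] by (simp add: dagger_def)
  then have c: "P $ 2 $ 1 = cnj b" and ra: "cnj a = a"
    by (simp_all add: a_def b_def)
  have sq: "a * a + b * cnj b = 1" "a * b + b * d = 0" "cnj b * a + d * cnj b = 0"
    "cnj b * b + d * d = 1"
    using P(2) c by (simp_all add: mat_simps a_def b_def d_def)
  \<comment> \<open>If the trace is nonzero, the off-diagonal equation forces \<open>b = 0\<close>.
    Then \<open>P\<close> is diagonal with equal entries 1 or -1, and both cases are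
    excluded.\<close>
  have d: "d = - a"
  proof (rule ccontr)
    assume "d \<noteq> - a"
    then have "a + d \<noteq> 0" by (simp add: add_eq_0_iff)
    moreover have "b * (a + d) = 0" using sq(2) by (simp add: algebra_simps)
    ultimately have b: "b = 0" by simp
    with sq have "a = 1 \<or> a = -1" "d = 1 \<or> d = -1"
      by (simp_all add: square_eq_1_iff)
    with \<open>d \<noteq> - a\<close> have "a = 1 \<and> d = 1 \<or> a = -1 \<and> d = -1" by auto
    with b c P(3,4) show False
      by (auto simp: vec_eq_iff forall_2 mat_def a_def b_def d_def)
  qed
  \<comment> \<open>The anticommutator of \<open>P\<close> and \<open>flip\<close> is the scalar
    \<open>b + cnj b\<close>, so \<open>P + flip\<close> squares to \<open>r\<close> times the
    identity.\<close>
  define r where "r = 2 + 2 * Re b"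
  have "cmod b \<le> 1"
  proof -
    have "a * a + of_real ((cmod b)\<^sup>2) = 1" using sq(1) by (simp only: complex_norm_square)
    moreover have "a = of_real (Re a)" using ra by (simp add: complex_eq_iff)
    ultimately have "of_real ((Re a)\<^sup>2 + (cmod b)\<^sup>2) = (1 :: complex)"
      by (metis of_real_add of_real_mult power2_eq_square)
    then have "(Re a)\<^sup>2 + (cmod b)\<^sup>2 = 1"
      by (metis of_real_eq_1_iff)
    then have "(cmod b)\<^sup>2 \<le> 1\<^sup>2" using zero_le_power2[of "Re a"] unfolding one_power2 by linarith
    then show ?thesis by (rule power2_le_imp_le) simp
  qed
  then have Re: "\<bar>Re b\<bar> \<le> 1" using abs_Re_le_cmod[of b] by linarith
  have b2: "b + cnj b = of_real (2 * Re b)" by (simp add: complex_add_cnj)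
  show thesis
  proof (cases "r = 0")
    case True
    then have "Re b = - 1" by (simp add: r_def)
    have "b = - 1"
    proof -
      have "(cmod b)\<^sup>2 \<le> 1" using \<open>cmod b \<le> 1\<close> by (simp add: power_le_one)
      then show ?thesis using \<open>Re b = - 1\<close> by (simp add: cmod_power2 complex_eq_iff)
    qed
    with sq(1) have "a = 0" by simp
    \<comment> \<open>Here \<open>P\<close> is the negative of \<open>flip\<close>, and diag(1, -1)
      anticommutes with \<open>flip\<close>.\<close>
    define U :: "complex^2^2" where "U = (\<chi> i j. if i = j then if i = 1 then 1 else - 1 else 0)"
    have "unitary_matrix U"
      by (simp add: unitary_matrix_def U_def mat_simps)
    moreover have "U ** P ** dagger U = flip"
      using \<open>a = 0\<close> \<open>b = - 1\<close> c d by (simp add: mat_simps U_def a_def b_def d_def)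
    ultimately show thesis by (rule that)
  next
    case False
    then have r: "r > 0" using Re by (simp add: r_def)
    define T where "T = P + flip"
    define s :: real where "s = 1 / sqrt r"
    have e: "P $ 1 $ 1 = a" "P $ 1 $ 2 = b" "P $ 2 $ 1 = cnj b" "P $ 2 $ 2 = - a"
      using c d by (simp_all add: a_def b_def d_def)
    have TT: "T ** T = r *\<^sub>R mat 1"
      using sq b2 d by (simp add: T_def mat_simps e r_def scaleR_conv_of_real[where 'a = complex] algebra_simps)
    \<comment> \<open>Both \<open>P\<close> and \<open>flip\<close> square to 1, so (P + flip) P = 1
      + flip P = flip (P + flip).\<close>
    have TP: "T ** P = flip ** T"
    proof -
      have "T ** P = P ** P + flip ** P"
        by (simp add: T_def mat_simps algebra_simps)
      then show ?thesis
        by (simp add: T_def matrix_add_ldistrib P(2) add.commute)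
    qed
    have dT: "dagger T = T"
    proof -
      have "dagger T = dagger P + dagger flip"
        by (simp add: T_def dagger_def vec_eq_iff)
      then show ?thesis by (simp add: dP T_def)
    qed
    define U where "U = s *\<^sub>R T"
    have dU: "dagger U = U"
      by (simp add: U_def dagger_scaleR dT)
    have UU: "U ** U = mat 1"
    proof -
      have "U ** U = (s * s * r) *\<^sub>R mat 1"
        by (simp add: U_def matrix_scalar_ac TT flip: scalar_matrix_assoc)
      also have "s * s * r = 1" using r by (simp add: s_def field_simps)
      finally show ?thesis by simp
    qed
    have "unitary_matrix U"
      by (simp add: unitary_matrix_def dU UU)
    moreover have "U ** P = flip ** U"
      by (simp add: U_def matrix_scalar_ac TP flip: scalar_matrix_assoc)
    then have "U ** P ** dagger U = flip"
      by (simp add: dU UU flip: matrix_mul_assoc)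
    ultimately show thesis by (rule that)
  qed
qed

text \<open>The unitaries \<open>exp (\<i> \<theta> flip)\<close> rotate the plane spanned by the two components of \<open>M\<close> that are
  odd under \<open>flip\<close>; any rotation by an angle that is not a multiple of a right angle serves.\<close>

lemma flip_generic_basis:
  assumes "M \<noteq> flip ** M ** flip"
  obtains V where "unitary_matrix V" "V ** flip ** dagger V = flip"
    "(V ** M ** dagger V) $ 1 $ 1 \<noteq> (V ** M ** dagger V) $ 2 $ 2"
    "(V ** M ** dagger V) $ 1 $ 2 \<noteq> (V ** M ** dagger V) $ 2 $ 1"
proof (cases "M $ 1 $ 1 \<noteq> M $ 2 $ 2 \<and> M $ 1 $ 2 \<noteq> M $ 2 $ 1")
  case True
  have "dagger (mat 1) = mat 1" by (simp add: mat_simps)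
  with True show thesis
    by (intro that[of "mat 1"]) (simp_all add: unitary_matrix_def)
next
  case False
  \<comment> \<open>The angle with cosine 3/5 and sine 4/5 keeps all entries rational. The doubled
    angle has cosine -7/25 and sine 24/25, both nonzero.\<close>
  define V :: "complex^2^2" where "V = (\<chi> i j. if i = j then 3/5 else 4/5 * \<i>)"
  define C where "C = V ** M ** dagger V"
  have V: "unitary_matrix V" "V ** flip ** dagger V = flip"
    by (simp_all add: unitary_matrix_def V_def mat_simps)
  have C: "C $ 1 $ 1 - C $ 2 $ 2
      = (- 7 * (M $ 1 $ 1 - M $ 2 $ 2) + 24 * \<i> * (M $ 2 $ 1 - M $ 1 $ 2)) / 25"
    "C $ 1 $ 2 - C $ 2 $ 1
      = (- 7 * (M $ 1 $ 2 - M $ 2 $ 1) + 24 * \<i> * (M $ 2 $ 2 - M $ 1 $ 1)) / 25"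
    by (simp_all add: C_def V_def mat_simps field_simps)
  \<comment> \<open>Exactly one of the two odd components of \<open>M\<close> vanishes in this
    branch, so each odd component of \<open>C\<close> is a nonzero multiple of the other
    one.\<close>
  have "C $ 1 $ 1 \<noteq> C $ 2 $ 2" "C $ 1 $ 2 \<noteq> C $ 2 $ 1"
    using C False assms by (auto simp: flip_conj_eq)
  with V show thesis unfolding C_def by (rule that)
qed


section \<open>Coarse-grained scalar walks\<close>

lemma Hrot_walk_apply:
  assumes "\<psi> \<in> l2 (Hrot \<times> UNIV)"
  shows "coin_walk_op (Dinf\<lparr>carrier := Hrot\<rparr>) rot Ap Am Ae \<psi> ((m, s), i) =
    (if s then 0 else coin Ap \<psi> ((m + 1, False), i) + coin Am \<psi> ((m - 1, False), i)
       + coin Ae \<psi> ((m, False), i))"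
proof -
  \<comment> \<open>The inverse in the structure with carrier \<open>Hrot\<close> is a description
    over the smaller carrier; it agrees with the inverse in \<open>Dinf\<close> because
    \<open>Hrot\<close> is a subgroup.\<close>
  have "subgroup Hrot Dinf"
    unfolding Hrot_def by (rule group.generate_is_subgroup[OF group_Dinf]) simp
  then have "inv\<^bsub>Dinf\<lparr>carrier := Hrot\<rparr>\<^esub> rot = inv\<^bsub>Dinf\<^esub> rot"
    by (rule group.m_inv_consistent[OF group_Dinf]) (simp add: Hrot_eq rot_def)
  then show ?thesis
    using assms
    by (simp add: coin_walk_op_def rreg_tensor_def rreg_def coin_def Hrot_eq rot_def)
qed

lemma Z_walk_unitary_of_Hrot:
  assumes "unitary_op (Hrot \<times> UNIV) (coin_walk_op (Dinf\<lparr>carrier := Hrot\<rparr>) rot Ap Am Ae)"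
  shows "unitary_op UNIV (Z_walk_op Ap Am Ae)"
proof (rule unitary_op_transport[OF _ assms])
  let ?e = "\<lambda>(m :: int, j :: 2). ((m, False), j)"
  let ?R = "reindex UNIV ?e :: _ \<Rightarrow> int \<times> 2 \<Rightarrow> complex"
  have e: "bij_betw ?e UNIV (Hrot \<times> UNIV)"
    by (rule bij_betw_byWitness[where f' = "\<lambda>((m, s), j). (m, j)"]) (auto simp: Hrot_eq)
  then show "l2_iso (Hrot \<times> UNIV) UNIV ?R" by (rule l2_iso_reindex)
  fix \<psi> :: "(int \<times> bool) \<times> 2 \<Rightarrow> complex" assume \<psi>: "\<psi> \<in> l2 (Hrot \<times> UNIV)"
  show "Z_walk_op Ap Am Ae (?R \<psi>) = ?R (coin_walk_op (Dinf\<lparr>carrier := Hrot\<rparr>) rot Ap Am Ae \<psi>)"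
    using Z_walk_apply[OF reindex_in_l2[OF e \<psi>]] Hrot_walk_apply[OF \<psi>]
    by (auto simp: fun_eq_iff reindex_def coin_def)
qed

section \<open>Matrix elements of a coarse-graining\<close>

lemma coset_repsE:
  assumes "coset_reps c"
  obtains p q where "c 1 = (p, False)" "c 2 = (q, True)"
  using assms by (auto simp: coset_reps_def Hrot_eq r_coset_def refl_elt_def)

lemma coarse_graining_U_H:
  assumes "coset_reps c" "f \<in> l2 UNIV"
  shows "coarse_graining c A (U_H c f) = U_H c (A f)"
  using U_H_bij[OF assms(1)] assms(2)
  by (auto simp: coarse_graining_def bij_betw_def)

lemma coarse_graining_unitary:
  assumes c: "coset_reps c" and A: "unitary_op UNIV A"
  shows "unitary_op (Hrot \<times> UNIV) (coarse_graining c A)"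
proof (rule unitary_op_transport[OF _ A])
  have "U_H c = reindex (Hrot \<times> UNIV) (\<lambda>(x, j). x \<otimes>\<^bsub>Dinf\<^esub> c j)"
    by (auto simp: U_H_def reindex_def fun_eq_iff)
  then show "l2_iso UNIV (Hrot \<times> UNIV) (U_H c)"
    using l2_iso_reindex[OF coset_reps_bij[OF c]] by simp
  show "coarse_graining c A (U_H c f) = U_H c (A f)" if "f \<in> l2 UNIV" for f
    using c that by (rule coarse_graining_U_H)
qed

text \<open>Both operators are applied to the state |e>|j>, which is the image of
  \<open>ket (c j)\<close> under \<open>U_H c\<close>, and evaluated at site a^(-n) and index i. The
  only group element contributing to the scalar walk is c_i^(-1) a^n c_j.\<close>

lemma coarse_graining_amplitude:
  assumes A: "scalar_walk Dinf S z A" and c: "coset_reps c"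
    and eq: "coarse_graining c A = coin_walk_op (Dinf\<lparr>carrier := Hrot\<rparr>) rot Ap Am Ae"
  shows "(if inv\<^bsub>Dinf\<^esub> (c i) \<otimes>\<^bsub>Dinf\<^esub> ((n, False) \<otimes>\<^bsub>Dinf\<^esub> c j) \<in> S
      then z (inv\<^bsub>Dinf\<^esub> (c i) \<otimes>\<^bsub>Dinf\<^esub> ((n, False) \<otimes>\<^bsub>Dinf\<^esub> c j)) else 0)
    = (if n = 1 then Ap $ i $ j else if n = - 1 then Am $ i $ j else if n = 0 then Ae $ i $ j else 0)"
proof -
  interpret group Dinf by (rule group_Dinf)
  let ?g = "inv\<^bsub>Dinf\<^esub> (c i) \<otimes>\<^bsub>Dinf\<^esub> ((n, False) \<otimes>\<^bsub>Dinf\<^esub> c j)"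
  \<comment> \<open>The exponent is negative because T_a sends |e> to |a^(-1)>; thus
    \<open>n = 1\<close> picks out \<open>Ap\<close>.\<close>
  let ?x = "(- n, False) \<otimes>\<^bsub>Dinf\<^esub> c i"
  let ?f = "ket (c j)"
  have H: "(m, False) \<in> Hrot" for m by (simp add: Hrot_eq)
  have f: "?f \<in> l2 UNIV" by (simp add: ket_in_l2)
  have Uf: "U_H c ?f = ket ((0, False), j)"
    using U_H_ket[OF c H, of 0 j] by (cases "c j") simp
  have g: "?x \<otimes>\<^bsub>Dinf\<^esub> h = c j \<longleftrightarrow> h = ?g" for h
    by (cases "c i"; cases "c j"; cases h) auto
  have "coarse_graining c A (U_H c ?f) ((- n, False), i) = A ?f ?x"
    unfolding coarse_graining_U_H[OF c f] using H by (simp add: U_H_def)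
  also have "\<dots> = (\<Sum>h\<in>S. z h * (if ?x \<otimes>\<^bsub>Dinf\<^esub> h = c j then 1 else 0))"
    using A f by (simp add: scalar_walk_def rreg_def ket_def)
  also have "\<dots> = (\<Sum>h\<in>S. if h = ?g then z ?g else 0)"
    unfolding g by (rule sum.cong) auto
  also have "\<dots> = (if ?g \<in> S then z ?g else 0)"
    using A by (simp add: scalar_walk_def)
  finally have "(if ?g \<in> S then z ?g else 0) = coarse_graining c A (U_H c ?f) ((- n, False), i)" ..
  also have "\<dots> = coin_walk_op (Dinf\<lparr>carrier := Hrot\<rparr>) rot Ap Am Ae (ket ((0, False), j)) ((- n, False), i)"
    by (simp only: eq Uf)
  also have "\<dots> = (if n = 1 then Ap $ i $ j else if n = - 1 then Am $ i $ j else if n = 0 then Ae $ i $ j else 0)"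
    using H by (subst Hrot_walk_apply) (auto intro: ket_in_l2 simp: coin_ket)
  finally show ?thesis .
qed

text \<open>The representative of the second coset is a reflection, which inverts rotations. Hence
  each scalar amplitude appears twice: at (1,1) for a^n and at (2,2) for a^(-n), or likewise at
  (1,2) and (2,1). This is the symmetry under \<open>flip\<close>.\<close>

lemma is_coarse_grained_parity:
  assumes "is_coarse_grained Ap Am Ae"
  shows "Am = flip ** Ap ** flip" "Ae = flip ** Ae ** flip" "Ap \<noteq> 0"
    "unitary_op UNIV (Z_walk_op Ap Am Ae)"
proof -
  obtain S z A c where A: "scalar_walk Dinf S z A" and c: "coset_reps c"
    and eq: "coarse_graining c A = coin_walk_op (Dinf\<lparr>carrier := Hrot\<rparr>) rot Ap Am Ae"
    using assms by (auto simp: is_coarse_grained_def)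
  obtain p q where pq: "c 1 = (p, False)" "c 2 = (q, True)"
    using c by (rule coset_repsE)
  \<comment> \<open>With value 0 off \<open>S\<close>, entries can be compared whether or not the
    group element belongs to \<open>S\<close>.\<close>
  define y where "y h = (if h \<in> S then z h else 0)" for h
  note amp = coarse_graining_amplitude[OF A c eq, folded y_def]
  have y11: "y (n, False) = (if n = 1 then Ap $ 1 $ 1 else if n = - 1 then Am $ 1 $ 1
      else if n = 0 then Ae $ 1 $ 1 else 0)" for n
    using amp[of 1 n 1] by (simp add: pq)
  have y22: "y (- n, False) = (if n = 1 then Ap $ 2 $ 2 else if n = - 1 then Am $ 2 $ 2
      else if n = 0 then Ae $ 2 $ 2 else 0)" for n
    using amp[of 2 n 2] by (simp add: pq)
  have y12: "y (n + (q - p), True) = (if n = 1 then Ap $ 1 $ 2 else if n = - 1 then Am $ 1 $ 2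
      else if n = 0 then Ae $ 1 $ 2 else 0)" for n
    using amp[of 1 n 2] by (simp add: pq algebra_simps)
  have y21: "y (- n + (q - p), True) = (if n = 1 then Ap $ 2 $ 1 else if n = - 1 then Am $ 2 $ 1
      else if n = 0 then Ae $ 2 $ 1 else 0)" for n
    using amp[of 2 n 1] by (simp add: pq algebra_simps)
  show Am: "Am = flip ** Ap ** flip"
    using y11[of 1] y11[of "-1"] y22[of 1] y22[of "-1"] y12[of 1] y12[of "-1"] y21[of 1] y21[of "-1"]
    by (simp add: flip_conj_eq)
  show "Ae = flip ** Ae ** flip"
    using y11[of 0] y22[of 0] y12[of 0] y21[of 0] by (simp add: flip_conj_eq)
  show "Ap \<noteq> 0"
  proof
    assume Ap0: "Ap = 0"
    with Am have Am0: "Am = 0" by simp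
    \<comment> \<open>Without hops only the amplitudes for \<open>n = 0\<close> survive. They belong
      to the identity and a single reflection, which form a subgroup of order two and cannot
      generate the whole group.\<close>
    let ?K = "{(0, False), (q - p, True)}"
    have z0: "z h \<noteq> 0" if "h \<in> S" for h
      using A that by (simp add: scalar_walk_def)
    have S: "S \<subseteq> ?K"
    proof
      fix h assume h: "h \<in> S"
      obtain m s where ms: "h = (m, s)" by (cases h)
      show "h \<in> ?K"
      proof (cases s)
        case True
        then show ?thesis using y12[of "m - (q - p)"] z0[OF h] h ms Ap0 Am0
          by (simp add: y_def split: if_splits)
      next
        case False
        then show ?thesis using y11[of m] z0[OF h] h ms Ap0 Am0
          by (simp add: y_def split: if_splits)
      qed
    qed
    interpret group Dinf by (rule group_Dinf)
    have "subgroup ?K Dinf"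
      by (rule subgroupI) auto
    then have "generate Dinf S \<subseteq> ?K"
      using S by (intro generate_subgroup_incl)
    moreover have "generate Dinf S = UNIV"
      using A by (simp add: scalar_walk_def)
    ultimately have "(1, False) \<in> ?K" by blast
    then show False by simp
  qed
  have "unitary_op UNIV A" using A unfolding scalar_walk_def Dinf_simps by blast
  from coarse_graining_unitary[OF c this] show "unitary_op UNIV (Z_walk_op Ap Am Ae)"
    unfolding eq by (rule Z_walk_unitary_of_Hrot)
qed

section \<open>From symmetric coefficients back to a scalar walk\<close>

lemma generate_Dinf:
  assumes "(1, False) \<in> S \<or> (- 1, False) \<in> S" "(l, True) \<in> S"
  shows "generate Dinf S = UNIV"
proof -
  interpret group Dinf by (rule group_Dinf)
  have sub: "subgroup (generate Dinf S) Dinf"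
    by (rule generate_is_subgroup) simp
  have "rot \<in> generate Dinf S"
    using assms(1) generate.incl[of "(1, False)" S Dinf] generate.inv[of "(- 1, False)" S Dinf]
    by (auto simp: rot_def)
  then have "Hrot \<subseteq> generate Dinf S"
    unfolding Hrot_def by (intro generate_subgroup_incl sub) simp
  then have H: "(m, False) \<in> generate Dinf S" for m
    by (auto simp: Hrot_eq)
  have "(m, s) \<in> generate Dinf S" for m s
  proof (cases s)
    case True
    then show ?thesis
      using generate.eng[OF H[of "m - l"] generate.incl[OF assms(2)]] by simp
  qed (simp add: H)
  then show ?thesis by auto
qed

text \<open>With the representatives e and r, the first rows of the coefficients prescribe the
  amplitudes of the scalar walk, and the symmetry under \<open>flip\<close> makes the second rows
  come out right. The conditions on the entries of \<open>Bp\<close> supply a generating rotation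
  and a reflection.\<close>

lemma is_coarse_grainedI:
  assumes p: "Bm = flip ** Bp ** flip" and e: "Be = flip ** Be ** flip"
    and W: "unitary_op UNIV (Z_walk_op Bp Bm Be)"
    and d: "Bp $ 1 $ 1 \<noteq> 0 \<or> Bp $ 2 $ 2 \<noteq> 0" and o: "Bp $ 1 $ 2 \<noteq> 0 \<or> Bp $ 2 $ 1 \<noteq> 0"
  shows "is_coarse_grained Bp Bm Be"
proof -
  \<comment> \<open>The amplitude of a^n r^s is the entry of the first row, in column 1 or 2
    according to \<open>s\<close>, of the coefficient belonging to \<open>n\<close>.\<close>
  define z where "z = (\<lambda>(n :: int, s). (if n = 1 then Bp else if n = - 1 then Bm else if n = 0 then Be else 0)
      $ 1 $ (if s then 2 else 1))"
  define S where "S = {h. z h \<noteq> 0}"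
  define c :: "2 \<Rightarrow> int \<times> bool" where "c = (\<lambda>i. (0, i = 2))"
  define A where "A = restrict (\<lambda>f x. \<Sum>h\<in>S. z h * rreg Dinf h f x) (l2 UNIV)"
  let ?N = "{- 1, 0, 1} \<times> (UNIV :: bool set)"
  have SN: "S \<subseteq> ?N"
    by (auto simp: S_def z_def split: if_splits)
  note p' = p[unfolded flip_conj_eq]
  have e': "Be $ 2 $ 2 = Be $ 1 $ 1" "Be $ 2 $ 1 = Be $ 1 $ 2"
    using e[unfolded flip_conj_eq] by blast+
  have A': "A f x = (\<Sum>n\<in>{- 1, 0, 1}. \<Sum>s\<in>UNIV. z (n, s) * f (x \<otimes>\<^bsub>Dinf\<^esub> (n, s)))"
    if "f \<in> l2 UNIV" for f x
  proof -
    have "A f x = (\<Sum>h\<in>S. z h * f (x \<otimes>\<^bsub>Dinf\<^esub> h))"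
      using that by (simp add: A_def rreg_def)
    also have "\<dots> = (\<Sum>h\<in>?N. z h * f (x \<otimes>\<^bsub>Dinf\<^esub> h))"
      using SN by (intro sum.mono_neutral_left) (auto simp: S_def)
    also have "\<dots> = (\<Sum>n\<in>{- 1, 0, 1}. \<Sum>s\<in>UNIV. z (n, s) * f (x \<otimes>\<^bsub>Dinf\<^esub> (n, s)))"
      by (simp only: sum.cartesian_product case_prod_unfold prod.collapse)
    finally show ?thesis .
  qed
  \<comment> \<open>At a point a^m r the amplitude for a^n reads the value at \<open>m - n\<close>,
    which exchanges the roles of \<open>Bp\<close> and \<open>Bm\<close>; by \<open>p'\<close> and
    \<open>e'\<close> the first rows then turn into the second rows.\<close>
  have A: "A f (m, s) = (\<Sum>t\<in>UNIV. Bp $ (if s then 2 else 1) $ (if t then 2 else 1) * f (m + 1, t)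
      + Bm $ (if s then 2 else 1) $ (if t then 2 else 1) * f (m - 1, t)
      + Be $ (if s then 2 else 1) $ (if t then 2 else 1) * f (m, t))"
    if "f \<in> l2 UNIV" for f m s
    using p' e' by (cases s) (simp_all add: A'[OF that] z_def UNIV_bool)
  have c: "coset_reps c"
    by (auto simp: coset_reps_def c_def Hrot_eq r_coset_def refl_elt_def)
  have coset: "Hrot #>\<^bsub>Dinf\<^esub> c i = UNIV \<times> {i = 2}" for i
    by (auto simp: Hrot_eq r_coset_def c_def)
  \<comment> \<open>Rotations preserve the two cosets and reflections exchange them.\<close>
  have tau: "coset_tau c (n, s) j = (if (j = 2) = s then 1 else 2)" for n s j
    unfolding coset_tau_def coset
    by (rule the_equality) (use exhaust_2 in \<open>auto simp: c_def split: if_splits\<close>)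
  have "coordination_two c S"
    unfolding coordination_two_def
  proof (intro ballI allI)
    fix h j assume "h \<in> S"
    obtain n s where h: "h = (n, s)" by (cases h)
    have n: "n = - 1 \<or> n = 0 \<or> n = 1" using SN \<open>h \<in> S\<close> h by auto
    have cs: "c i = (0, i = 2)" for i by (simp add: c_def)
    show "c (coset_tau c h j) \<otimes>\<^bsub>Dinf\<^esub> h \<otimes>\<^bsub>Dinf\<^esub> inv\<^bsub>Dinf\<^esub> (c j)
        \<in> {\<one>\<^bsub>Dinf\<^esub>, rot, inv\<^bsub>Dinf\<^esub> rot}"
      unfolding h tau cs using n by (cases "j = 2"; cases s) (auto simp: rot_def)
  qed
  moreover
  have UH: "U_H c f ((m, s), i) = (if s then 0 else f (m, i = 2))" for f m s i
    by (simp add: U_H_def Hrot_eq c_def)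
  have "coarse_graining c A = coin_walk_op (Dinf\<lparr>carrier := Hrot\<rparr>) rot Bp Bm Be"
  proof
    fix \<psi>
    show "coarse_graining c A \<psi> = coin_walk_op (Dinf\<lparr>carrier := Hrot\<rparr>) rot Bp Bm Be \<psi>"
    proof (cases "\<psi> \<in> l2 (Hrot \<times> UNIV)")
      case True
      then obtain f where f: "f \<in> l2 UNIV" "\<psi> = U_H c f"
        using U_H_bij[OF c] by (auto simp: bij_betw_def)
      have "U_H c (A f) ((m, s), i)
          = coin_walk_op (Dinf\<lparr>carrier := Hrot\<rparr>) rot Bp Bm Be (U_H c f) ((m, s), i)" for m s i
        using exhaust_2[of i] True f(2)
        by (auto simp: UH Hrot_walk_apply A[OF f(1)] UNIV_bool coin_def sum_2)
      then show ?thesis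
        by (auto simp: f coarse_graining_U_H[OF c f(1)] fun_eq_iff)
    next
      case False
      then have "\<psi> \<notin> l2 (carrier (Dinf\<lparr>carrier := Hrot\<rparr>) \<times> UNIV)" by simp
      with False show ?thesis
        by (simp add: coarse_graining_def coin_walk_op_def)
    qed
  qed
  moreover have "scalar_walk Dinf S z A"
  proof -
    have "finite S" using SN by (rule finite_subset) simp
    moreover have "generate Dinf S = UNIV"
    proof -
      \<comment> \<open>By \<open>p'\<close> the second row of \<open>Bp\<close> is the first row of
        \<open>Bm\<close> with its entries exchanged, so a nonzero entry there is an amplitude for
        \<open>n = - 1\<close>.\<close>
      have "(1, False) \<in> S \<or> (- 1, False) \<in> S"
        using d p' by (auto simp: S_def z_def)
      moreover have "(1, True) \<in> S \<or> (- 1, True) \<in> S"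
        using o p' by (auto simp: S_def z_def)
      ultimately show ?thesis using generate_Dinf by blast
    qed
    moreover have "unitary_op UNIV A"
    proof (rule unitary_op_transport[OF _ W])
      \<comment> \<open>The element a^m r^s corresponds to site \<open>m\<close> with coin index 1
        or 2; in this labelling \<open>A\<close> is the given walk on the line.\<close>
      let ?e = "\<lambda>(m :: int, s). (m, if s then 2 else 1 :: 2)"
      let ?R = "reindex UNIV ?e :: _ \<Rightarrow> int \<times> bool \<Rightarrow> complex"
      have e: "bij_betw ?e UNIV UNIV"
        by (rule bij_betw_byWitness[where f' = "\<lambda>(m, j). (m, j = 2)"]) (use exhaust_2 in auto)
      then show "l2_iso UNIV UNIV ?R" by (rule l2_iso_reindex)
      fix \<psi> :: "int \<times> 2 \<Rightarrow> complex" assume \<psi>: "\<psi> \<in> l2 UNIV"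
      show "A (?R \<psi>) = ?R (Z_walk_op Bp Bm Be \<psi>)"
        using A[OF reindex_in_l2[OF e \<psi>]] Z_walk_apply[OF \<psi>]
        by (auto simp: fun_eq_iff reindex_def UNIV_bool coin_def sum_2)
    qed
    ultimately show ?thesis
      by (simp add: scalar_walk_def A_def S_def)
  qed
  ultimately show ?thesis
    using c unfolding is_coarse_grained_def by blast
qed


section \<open>The two classes coincide\<close>

text \<open>In the original basis of the coarse-graining \<open>flip\<close> is a parity matrix;
  after the local change of basis \<open>U\<close> its conjugate by \<open>U\<close> takes
  over.\<close>

lemma W_CG_subset_W_P: "W_CG \<subseteq> W_P"
proof
  fix W assume "W \<in> W_CG"
  then obtain Bp Bm Be Ap Am Ae U where W: "W = Z_walk_op Bp Bm Be"
    and cg: "is_coarse_grained Ap Am Ae" and U: "unitary_matrix U"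
    and "\<forall>k\<in>{-pi..pi}. walk_symbol Bp Bm Be k = U ** walk_symbol Ap Am Ae k ** dagger U"
    unfolding W_CG_def by blast
  then have B: "Bp = U ** Ap ** dagger U" "Bm = U ** Am ** dagger U" "Be = U ** Ae ** dagger U"
    unfolding walk_symbol_conj walk_symbol_inject by simp_all
  note par = is_coarse_grained_parity[OF cg]
  have Ap: "Ap = flip ** Am ** flip"
    using par(1) by (simp add: flip_conj_eq)
  define P where "P = U ** flip ** dagger U"
  have P: "P = dagger P"
    by (simp add: P_def dagger_mult matrix_mul_assoc)
  have PP: "P ** P = mat 1"
    unfolding P_def conj_mult[OF U] using U by (simp add: unitary_matrix_def)
  have "P \<noteq> mat 1"
  proof
    assume "P = mat 1"
    then have "flip = dagger U ** mat 1 ** U"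
      unfolding P_def using conj_cancel[OF U, of flip] by simp
    then have "flip = mat 1" using U by (simp add: unitary_matrix_def)
    then show False by (simp add: mat_simps)
  qed
  moreover have "P ** Bp ** dagger P = Bm" "P ** Bm ** dagger P = Bp" "P ** Be ** dagger P = Be"
    unfolding P[symmetric] unfolding P_def B
    by (simp_all add: conj_mult[OF U] flip: par(1,2) Ap)
  then have "\<forall>k\<in>{-pi..pi}. P ** walk_symbol Bp Bm Be k ** dagger P = walk_symbol Bp Bm Be (- k)"
    by (simp add: walk_symbol_conj walk_symbol_minus)
  moreover have "Bp \<noteq> 0" "Bm \<noteq> 0"
    using conj_cancel[OF U, of Ap] conj_cancel[OF U, of Am] par(3) Ap by (auto simp: B)
  moreover have "unitary_op (UNIV \<times> UNIV) W"
    using Z_walk_conj_unitary[OF U par(4)] by (simp add: W B)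
  ultimately show "W \<in> W_P"
    unfolding W_P_def using W P PP by blast
qed

text \<open>Two changes of basis are composed: \<open>U\<close> turns the parity matrix into
  \<open>flip\<close>, and \<open>V\<close> preserves \<open>flip\<close> while making the entries
  of the hop matrix generic enough for the dihedral group to be generated.\<close>

lemma W_P_subset_W_CG: "W_P \<subseteq> W_CG"
proof
  fix W assume "W \<in> W_P"
  then obtain Ap Am Ae P where W: "W = Z_walk_op Ap Am Ae" and nz: "Ap \<noteq> 0"
    and u: "unitary_op UNIV (Z_walk_op Ap Am Ae)"
    and P: "P = dagger P" "P ** P = mat 1" "P \<noteq> mat 1"
    and "\<forall>k\<in>{-pi..pi}. P ** walk_symbol Ap Am Ae k ** dagger P = walk_symbol Ap Am Ae (- k)"
    unfolding W_P_def UNIV_Times_UNIV by blast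
  then have PA: "P ** Ap ** P = Am" "P ** Ae ** P = Ae"
    unfolding walk_symbol_conj walk_symbol_minus walk_symbol_inject P(1)[symmetric] by simp_all
  have neq: "Ap \<noteq> Am"
    using u nz by (rule Z_walk_hops_distinct)
  \<comment> \<open>Conjugation by the negative identity is trivial, so parity would equate the two
    hop matrices.\<close>
  have "P \<noteq> - mat 1"
  proof
    assume "P = - mat 1"
    with PA(1) have "Am = Ap" by (auto simp: mat_simps)
    with neq show False by simp
  qed
  then obtain U where U: "unitary_matrix U" "U ** P ** dagger U = flip"
    using P parity_conj_flip by blast
  have "U ** Ap ** dagger U \<noteq> flip ** (U ** Ap ** dagger U) ** flip"
  proof
    assume "U ** Ap ** dagger U = flip ** (U ** Ap ** dagger U) ** flip"
    then have "U ** Ap ** dagger U = U ** Am ** dagger U"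
      by (simp add: U(2)[symmetric] conj_mult[OF U(1)] PA)
    then show False
      using conj_cancel[OF U(1), of Ap] conj_cancel[OF U(1), of Am] neq by simp
  qed
  then obtain V where V: "unitary_matrix V" "V ** flip ** dagger V = flip"
    and entries: "(V ** (U ** Ap ** dagger U) ** dagger V) $ 1 $ 1
        \<noteq> (V ** (U ** Ap ** dagger U) ** dagger V) $ 2 $ 2"
      "(V ** (U ** Ap ** dagger U) ** dagger V) $ 1 $ 2
        \<noteq> (V ** (U ** Ap ** dagger U) ** dagger V) $ 2 $ 1"
    by (rule flip_generic_basis)
  define T where "T = V ** U"
  have T: "unitary_matrix T"
    unfolding T_def using V(1) U(1) by (rule unitary_matrix_mult)
  have Tc: "V ** (U ** M ** dagger U) ** dagger V = T ** M ** dagger T" for M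
    by (simp add: T_def dagger_mult matrix_mul_assoc)
  have TP: "T ** P ** dagger T = flip"
    by (simp flip: Tc add: U(2) V(2))
  have "is_coarse_grained (T ** Ap ** dagger T) (T ** Am ** dagger T) (T ** Ae ** dagger T)"
  proof (rule is_coarse_grainedI)
    show "T ** Am ** dagger T = flip ** (T ** Ap ** dagger T) ** flip"
      "T ** Ae ** dagger T = flip ** (T ** Ae ** dagger T) ** flip"
      by (simp_all add: TP[symmetric] conj_mult[OF T] PA)
    show "unitary_op UNIV (Z_walk_op (T ** Ap ** dagger T) (T ** Am ** dagger T) (T ** Ae ** dagger T))"
      using T u by (rule Z_walk_conj_unitary)
  \<comment> \<open>Two unequal entries cannot both be zero, which gives a nonzero entry on and off
    the diagonal.\<close>
  qed (use entries[unfolded Tc] in auto)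
  \<comment> \<open>The given walk has to be recovered from the coarse-grained one, so the local
    change of basis is the inverse of \<open>T\<close>.\<close>
  moreover have "\<forall>k\<in>{-pi..pi}. walk_symbol Ap Am Ae k = dagger T **
      walk_symbol (T ** Ap ** dagger T) (T ** Am ** dagger T) (T ** Ae ** dagger T) k ** dagger (dagger T)"
    by (simp add: walk_symbol_conj conj_cancel[OF T])
  ultimately show "W \<in> W_CG"
    unfolding W_CG_def using W unitary_matrix_dagger[OF T] by blast
qed

theorem proposition2:
  shows "W_CG = W_P"
  using W_CG_subset_W_P W_P_subset_W_CG by (rule subset_antisym)

end
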